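(* Let $R$ be either the right open half strip $\{\tfrac12<\Re(s)<1\}$ or the left open half strip $\{0<\Re(s)<\tfrac12\}$. The Riemann Hypothesis is true if and only if for every compact disc $K\subset R$ there exists $N_0\in\mathbb{N}$ such that for infinitely many $N>N_0$, $H_N(s)\neq0$ for all $s\in K$.
   Context: $\zeta$ is the Riemann zeta function; the Riemann Hypothesis states that every zero of $\zeta$ in the critical strip $0<\Re(s)<1$ has real part $\tfrac12$. For $N\in\mathbb{N}$ and $s\ne1$, $H_N(s)=\sum_{n=1}^{N}n^{-s}+\frac{N^{1-s}}{s-1}$. *)

theory Defs
  imports "HOL-Complex_Analysis.Complex_Analysis"
begin

text \<open>
  The analytic continuation to \<open>\<complex> - {1}\<close> of the Dirichlet series \<open>\<Sum>n\<ge>1. n\<^sup>-\<^sup>s\<close>, \<open>Re s > 1\<close>.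
  By the identity theorem the choice determines every value except the one at the pole
  \<open>s = 1\<close>, which is left unspecified.
\<close>

definition zeta :: "complex \<Rightarrow> complex" where
  "zeta = (SOME f. f holomorphic_on (- {1}) \<and>
     (\<forall>s. Re s > 1 \<longrightarrow> (\<lambda>n. of_nat (Suc n) powr (- s)) sums f s))"

definition Riemann_Hypothesis :: bool where
  "Riemann_Hypothesis \<longleftrightarrow>
     (\<forall>s. 0 < Re s \<and> Re s < 1 \<and> zeta s = 0 \<longrightarrow> Re s = 1 / 2)"

definition H :: "nat \<Rightarrow> complex \<Rightarrow> complex" where
  "H N s = (\<Sum>n = 1..N. of_nat n powr (- s)) + of_nat N powr (1 - s) / (s - 1)"

end

theory Submission
  imports Defs
begin

text \<open>
  On \<open>Re s > 0\<close> the increments \<open>H\<^sub>N\<^sub>+\<^sub>1 - H\<^sub>N\<close> have norm at most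
  \<open>|s| N\<^sup>-\<^sup>\<sigma>\<^sup>-\<^sup>1\<close>, where \<open>\<sigma> = Re s\<close>, so \<open>H\<^sub>N\<close> converges
  to \<open>\<zeta>\<close> uniformly on compact sets avoiding \<open>1\<close>. Hence \<open>H\<^sub>N\<close> is eventually zero-free on a compact set
  on which \<open>\<zeta>\<close> has no zeros; conversely, by Hurwitz's theorem, a zero of \<open>\<zeta>\<close> in the interior of a disc
  forces zeros of all late \<open>H\<^sub>N\<close> in that disc. The functional equation makes the zeros in
  the critical strip symmetric under \<open>s \<mapsto> 1 - s\<close>, so either half of the strip detects every zero
  off the critical line.

  The functional equation comes from the Mellin transform of \<open>b(x) = 1 / (e\<^sup>x - 1)\<close>. Splitting the
  integral at \<open>1\<close> and subtracting \<open>1/x - 1/2\<close> near \<open>0\<close> continues \<open>\<Gamma>(s) \<zeta>(s)\<close> to \<open>Re s > -1\<close>; for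
  \<open>-1 < Re s < 0\<close> the result is the Mellin transform of \<open>b(x) - 1/x + 1/2 = \<Sum>n\<ge>1. 2x / (x\<^sup>2 + 4\<pi>\<^sup>2n\<^sup>2)\<close>,
  whose termwise evaluation is a multiple of \<open>\<zeta>(1 - s)\<close>. All interchanges are done for real \<open>s\<close>, where
  the terms are positive, and transported by the identity theorem.
\<close>

section \<open>Convergence of the approximants\<close>

text \<open>Mean value inequality on the segment between x and y: the derivative of z^(-s) has norm
  |s| t^(-Re s - 1) at a real point t, which decreases in t, so its value at the lower bound
  \<open>N\<close> dominates. The segment has length at most 1.\<close>

lemma norm_powr_diff_le:
  fixes s :: complex and x y N :: real
  assumes "0 < N" "N \<le> x" "N \<le> y" "\<bar>x - y\<bar> \<le> 1" "Re s > 0"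
  shows "norm (of_real x powr (-s) - of_real y powr (-s)) \<le> norm s * N powr (- Re s - 1)"
proof -
  let ?S = "closed_segment (of_real x :: complex) (of_real y)"
  have S: "\<exists>t. z = of_real t \<and> N \<le> t" if z: "z \<in> ?S" for z
  proof -
    obtain t where t: "z = of_real t" "t \<in> closed_segment x y"
      using z unfolding closed_segment_of_real by blast
    thus ?thesis using assms by (auto simp: closed_segment_eq_real_ivl split: if_splits)
  qed
  have "norm (of_real x powr (-s) - of_real y powr (-s)) \<le>
      (norm s * N powr (- Re s - 1)) * norm (of_real x - of_real y :: complex)"
  proof (rule field_differentiable_bound[of ?S])
    fix z assume z: "z \<in> ?S"
    then obtain t where t: "z = of_real t" "N \<le> t" using S by blast
    have nz: "z \<notin> \<real>\<^sub>\<le>\<^sub>0" using t assms by auto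
    show "((\<lambda>z. z powr (-s)) has_field_derivative (-s * z powr (-s - 1))) (at z within ?S)"
      using nz by (auto intro!: derivative_eq_intros)
    have "norm (-s * z powr (-s - 1)) = norm s * t powr (- Re s - 1)"
      using t assms by (simp add: norm_mult norm_powr_real_powr)
    also have "\<dots> \<le> norm s * N powr (- Re s - 1)"
      using t assms by (intro mult_left_mono powr_mono2') auto
    finally show "norm (-s * z powr (-s - 1)) \<le> norm s * N powr (- Re s - 1)" .
  qed auto
  also have "norm (of_real x - of_real y :: complex) \<le> 1"
    using assms(4) by (metis norm_of_real of_real_diff)
  hence "(norm s * N powr (- Re s - 1)) * norm (of_real x - of_real y :: complex)
      \<le> norm s * N powr (- Re s - 1)"
    by (intro mult_left_le) auto
  finally show ?thesis .
qed

text \<open>The increment is the integral of (N+1)^(-s) - t^(-s) over [N, N+1]. Instead of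
  integrating, the proof applies the mean value inequality to the antiderivative
  \<open>\<phi>\<close> of that integrand, whose derivative is a difference of powers covered by
  \<open>norm_powr_diff_le\<close>.\<close>

lemma norm_H_Suc_diff_le:
  assumes "N > 0" "Re s > 0" "s \<noteq> 1"
  shows "norm (H (Suc N) s - H N s) \<le> norm s * real N powr (- Re s - 1)"
proof -
  define c where "c = of_nat (Suc N) powr (-s)"
  define \<phi> where "\<phi> = (\<lambda>z. z * c + z powr (1 - s) / (s - 1))"
  have "H (Suc N) s - H N s = \<phi> (of_nat (Suc N)) - \<phi> (of_nat N)"
    by (simp add: H_def \<phi>_def c_def algebra_simps)
  also have "norm \<dots> \<le> (norm s * real N powr (- Re s - 1)) * norm (of_nat (Suc N) - of_nat N :: complex)"
  proof (rule field_differentiable_bound[of "closed_segment (of_nat N) (of_nat (Suc N))"])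
    fix z :: complex assume z: "z \<in> closed_segment (of_nat N) (of_nat (Suc N))"
    have "closed_segment (of_nat N :: complex) (of_nat (Suc N)) =
        of_real ` closed_segment (real N) (real (Suc N))"
      by (metis closed_segment_of_real of_real_of_nat_eq)
    then obtain t where t: "z = of_real t" "real N \<le> t" "t \<le> real N + 1"
      using z by (auto simp: closed_segment_eq_real_ivl)
    have nz: "z \<notin> \<real>\<^sub>\<le>\<^sub>0" using t assms by auto
    show "(\<phi> has_field_derivative (c - z powr (-s)))
        (at z within closed_segment (of_nat N) (of_nat (Suc N)))"
    proof -
      have "((1 - s) * z powr (1 - s - 1)) / (s - 1) = - (z powr (-s))"
        using assms by (simp add: divide_simps) (simp add: algebra_simps)
      thus ?thesis
        unfolding \<phi>_def using nz assms by (auto intro!: derivative_eq_intros)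
    qed
    have "norm (of_real (real (Suc N)) powr (-s) - of_real t powr (-s))
        \<le> norm s * real N powr (- Re s - 1)"
      by (rule norm_powr_diff_le) (use t assms in auto)
    thus "norm (c - z powr (-s)) \<le> norm s * real N powr (- Re s - 1)"
      by (simp add: c_def t)
  qed auto
  finally show ?thesis by simp
qed

text \<open>A stand-in for zeta on Re s > 0. Nothing can be extracted from the choice in
  \<open>zeta\<close> before a continuation to the whole punctured plane is constructed, so
  everything up to \<open>zeta_exists\<close> is phrased with this limit.\<close>

definition zeta_lim :: "complex \<Rightarrow> complex" where "zeta_lim s = lim (\<lambda>N. H N s)"

lemma uniform_limit_H_zeta_lim:
  assumes "compact K" "K \<subseteq> {s. Re s > 0} - {1}"
  shows "uniform_limit K H zeta_lim sequentially"
proof (cases "K = {}")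
  case False
  obtain \<delta> where \<delta>: "\<delta> > 0" "\<And>s. s \<in> K \<Longrightarrow> \<delta> \<le> Re s"
  proof -
    have "continuous_on K Re" by (intro continuous_intros)
    from continuous_attains_inf[OF assms(1) False this] obtain z where "z \<in> K" "\<forall>y\<in>K. Re z \<le> Re y"
      by auto
    thus ?thesis using that[of "Re z"] assms(2) by auto
  qed
  obtain B where B: "\<And>s. s \<in> K \<Longrightarrow> norm s \<le> B"
    using compact_imp_bounded[OF assms(1)] unfolding bounded_iff by blast
  have B0: "B \<ge> 0" using B False norm_ge_zero order_trans by blast
  \<comment> \<open>The Weierstrass test is applied to the telescoping increments, with Re s
    replaced by its minimum on \<open>K\<close> and |s| by a bound. The sum starts at
    \<open>H 1\<close> because the increment estimate needs a positive index.\<close>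
  define f where "f = (\<lambda>n s. H (Suc (Suc n)) s - H (Suc n) s)"
  have "uniformly_convergent_on K (\<lambda>n s. \<Sum>i<n. f i s)"
  proof (rule Weierstrass_m_test')
    fix n s assume s: "s \<in> K"
    have s': "Re s > 0" "s \<noteq> 1" using assms(2) s by auto
    have "norm (f n s) \<le> norm s * real (Suc n) powr (- Re s - 1)"
      unfolding f_def by (rule norm_H_Suc_diff_le) (use s' in auto)
    also have "\<dots> \<le> B * real (Suc n) powr (- \<delta> - 1)"
      using B[OF s] \<delta>(2)[OF s] B0 by (intro mult_mono powr_mono) auto
    finally show "norm (f n s) \<le> B * real (Suc n) powr (- \<delta> - 1)" .
  next
    have "summable (\<lambda>n. real (Suc n) powr (- \<delta> - 1))"
      using \<delta>(1) by (subst summable_Suc_iff) (simp add: summable_real_powr_iff)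
    thus "summable (\<lambda>n. B * real (Suc n) powr (- \<delta> - 1))" by (rule summable_mult)
  qed
  then obtain l where l: "uniform_limit K (\<lambda>n s. \<Sum>i<n. f i s) l sequentially"
    unfolding uniformly_convergent_on_def by blast
  have "(\<Sum>i<n. f i s) = H (Suc n) s - H 1 s" for n s
    unfolding f_def using sum_lessThan_telescope[of "\<lambda>n. H (Suc n) s" n] by simp
  hence "uniform_limit K (\<lambda>n s. H (Suc n) s - H 1 s) l sequentially"
    using l by simp
  hence "uniform_limit K (\<lambda>n s. H (Suc n) s - H 1 s + H 1 s) (\<lambda>s. l s + H 1 s) sequentially"
    by (intro uniform_limit_intros)
  hence *: "uniform_limit K (\<lambda>n. H (Suc n)) (\<lambda>s. l s + H 1 s) sequentially"
    by simp
  hence u: "uniform_limit K H (\<lambda>s. l s + H 1 s) sequentially"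
    by (rule filterlim_sequentially_Suc[THEN iffD1])
  have "zeta_lim s = l s + H 1 s" if "s \<in> K" for s
    unfolding zeta_lim_def by (rule limI) (rule tendsto_uniform_limitI[OF u that])
  thus ?thesis using u by (simp cong: uniform_limit_cong')
qed auto

lemma holomorphic_on_H [holomorphic_intros]: "H N holomorphic_on - {1}"
  unfolding H_def[abs_def] by (cases "N = 0") (auto intro!: holomorphic_intros)

lemma open_right_half_plane_delete: "open ({s. Re s > a} - {b})"
  by (intro open_delete open_halfspace_Re_gt)

lemma connected_right_half_plane_delete: "connected ({s. Re s > a} - {b})"
  by (intro connected_open_delete open_halfspace_Re_gt convex_connected convex_halfspace_Re_gt) auto

lemma holomorphic_on_zeta_lim: "zeta_lim holomorphic_on {s. Re s > 0} - {1}"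
proof (rule holomorphic_uniform_sequence[of _ H])
  fix x :: complex assume "x \<in> {s. Re s > 0} - {1}"
  then obtain d where "d > 0" "cball x d \<subseteq> {s. Re s > 0} - {1}"
    using open_right_half_plane_delete[of 0 1] unfolding open_contains_cball by blast
  thus "\<exists>d>0. cball x d \<subseteq> {s. Re s > 0} - {1} \<and> uniform_limit (cball x d) H zeta_lim sequentially"
    by (intro exI[of _ d]) (auto intro: uniform_limit_H_zeta_lim)
qed (auto intro: open_right_half_plane_delete holomorphic_on_subset[OF holomorphic_on_H])

lemma sums_zeta_lim:
  assumes "Re s > 1"
  shows "(\<lambda>n. of_nat (Suc n) powr (-s)) sums zeta_lim s"
proof -
  have "uniform_limit {s} H zeta_lim sequentially"
    by (rule uniform_limit_H_zeta_lim) (use assms in auto)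
  hence 1: "(\<lambda>N. H N s) \<longlonglongrightarrow> zeta_lim s" by (rule tendsto_uniform_limitI) auto
  \<comment> \<open>For Re s > 1 the correction term vanishes in the limit and the bare partial sums
    remain.\<close>
  have "(\<lambda>N. of_nat N powr (1 - s)) \<longlonglongrightarrow> 0"
    by (rule tendsto_neg_powr_complex_of_nat[OF filterlim_ident]) (use assms in auto)
  hence "(\<lambda>N. H N s - of_nat N powr (1 - s) / (s - 1)) \<longlonglongrightarrow> zeta_lim s - 0 / (s - 1)"
    using assms by (intro tendsto_intros 1) auto
  hence "(\<lambda>N. \<Sum>n=1..N. of_nat n powr (-s)) \<longlonglongrightarrow> zeta_lim s" by (simp add: H_def)
  moreover have "(\<Sum>n=1..N. of_nat n powr (-s)) = (\<Sum>n<N. of_nat (Suc n) powr (-s))" for N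
    by (simp add: sum.atLeast1_atMost_eq)
  ultimately show ?thesis unfolding sums_def by simp
qed

section \<open>Partial fractions of the hyperbolic cotangent\<close>

definition bose :: "real \<Rightarrow> real" where "bose x = 1 / (exp x - 1)"

text \<open>The subtracted terms are the pole and the constant term of the Laurent expansion of
  \<open>bose\<close> at 0; the remainder is O(x).\<close>

definition bose_reg :: "real \<Rightarrow> real" where "bose_reg x = bose x - 1 / x + 1 / 2"

text \<open>Differentiate both sides of Gamma(z) Gamma(1 - z) = pi / sin(pi z), compare by
  uniqueness of derivatives, and divide out the common factor.\<close>

lemma Digamma_reflection:
  fixes z :: complex
  assumes "z \<notin> \<int>"
  shows "Digamma (1 - z) - Digamma z = of_real pi * cos (of_real pi * z) / sin (of_real pi * z)"
proof -
  have s: "sin (of_real pi * z) \<noteq> 0"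
  proof
    assume "sin (of_real pi * z) = 0"
    then obtain n :: int where "of_real pi * z = of_real (of_int n * pi)"
      unfolding sin_eq_0 by auto
    hence "z = of_int n" by simp
    thus False using assms by auto
  qed
  have "1 - (1 - z) \<notin> \<int>" using assms by simp
  hence "1 - z \<notin> \<int>" using Ints_diff[OF Ints_1] by blast
  hence z1: "z \<notin> \<int>\<^sub>\<le>\<^sub>0" "1 - z \<notin> \<int>\<^sub>\<le>\<^sub>0"
    using assms nonpos_Ints_subset_Ints by blast+
  have 1: "((\<lambda>z. Gamma z * Gamma (1 - z)) has_field_derivative
      (Gamma z * Gamma (1 - z)) * (Digamma z - Digamma (1 - z))) (at z)"
    using z1 by (auto intro!: derivative_eq_intros simp: algebra_simps)
  have "((\<lambda>z. of_real pi / sin (of_real pi * z)) has_field_derivative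
      - (of_real pi)\<^sup>2 * cos (of_real pi * z) / (sin (of_real pi * z))\<^sup>2) (at z)"
    using s by (auto intro!: derivative_eq_intros simp: power2_eq_square)
  from DERIV_unique[OF 1[unfolded Gamma_reflection_complex] this]
  have "of_real pi / sin (of_real pi * z) * (Digamma z - Digamma (1 - z)) =
      - (of_real pi)\<^sup>2 * cos (of_real pi * z) / (sin (of_real pi * z))\<^sup>2" .
  moreover have "B - A = P * C / S" if "P / S * (A - B) = - P\<^sup>2 * C / S\<^sup>2" "P \<noteq> 0" "S \<noteq> 0"
    for A B C P S :: complex
  proof -
    have "B - A = - (S / P) * (P / S * (A - B))" using that(2,3) by simp
    also have "\<dots> = P * C / S" unfolding that(1) using that(2,3) by (simp add: power2_eq_square)
    finally show ?thesis .
  qed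
  ultimately show ?thesis using s by simp
qed

text \<open>The value is pi coth(pi y) - 1/y. It arises from Digamma(1 + w) - Digamma(1 - w) at w =
  iy: in the limit formulas for the two Digamma values the logarithms cancel and leave the series,
  while the recurrence Digamma(1 + w) = Digamma(w) + 1/w and the reflection formula give the closed
  form.\<close>

lemma coth_partial_fractions:
  assumes "y > (0::real)"
  shows "(\<lambda>n. 2 * y / ((real n + 1)\<^sup>2 + y\<^sup>2)) sums (pi * (1 + 2 / (exp (2 * pi * y) - 1)) - 1 / y)"
proof -
  define w where "w = \<i> * of_real y"
  have w: "w \<noteq> 0" "w \<notin> \<int>" "1 + w \<noteq> 0" "1 - w \<noteq> 0"
    using assms by (auto simp: w_def complex_eq_iff elim!: Ints_cases)
  have nz: "of_nat n + 1 - w \<noteq> 0" "of_nat n + 1 + w \<noteq> 0" for n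
    using assms by (auto simp: w_def complex_eq_iff)
  have "(\<lambda>m. (of_real (ln (real m)) - (\<Sum>n<m. inverse (1 + w + of_nat n))) -
      (of_real (ln (real m)) - (\<Sum>n<m. inverse (1 - w + of_nat n)))) \<longlonglongrightarrow> Digamma (1 + w) - Digamma (1 - w)"
    by (intro tendsto_diff Digamma_LIMSEQ w)
  hence "(\<lambda>n. inverse (1 - w + of_nat n) - inverse (1 + w + of_nat n)) sums (Digamma (1 + w) - Digamma (1 - w))"
    unfolding sums_def by (simp add: sum_subtractf)
  also have "(\<lambda>n. inverse (1 - w + of_nat n) - inverse (1 + w + of_nat n)) =
      (\<lambda>n. \<i> * of_real (2 * y / ((real n + 1)\<^sup>2 + y\<^sup>2)))"
  proof
    fix n
    have "inverse (1 - w + of_nat n) - inverse (1 + w + of_nat n) =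
       2 * w / ((of_nat n + 1 - w) * (of_nat n + 1 + w))"
      using nz[of n] by (simp add: divide_simps) (simp add: algebra_simps)
    also have "(of_nat n + 1 - w) * (of_nat n + 1 + w) = of_real ((real n + 1)\<^sup>2 + y\<^sup>2)"
      by (simp add: w_def algebra_simps power2_eq_square)
    finally show "inverse (1 - w + of_nat n) - inverse (1 + w + of_nat n) =
        \<i> * of_real (2 * y / ((real n + 1)\<^sup>2 + y\<^sup>2))" by (simp add: w_def)
  qed
  also have "Digamma (1 + w) = Digamma w + 1 / w"
    using Digamma_plus1[OF w(1)] by (simp add: add.commute)
  also have "Digamma w + 1 / w - Digamma (1 - w) = 1 / w - (Digamma (1 - w) - Digamma w)"
    by simp
  also have "\<dots> = 1 / w - of_real pi * cos (of_real pi * w) / sin (of_real pi * w)"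
    by (subst Digamma_reflection) (use w in auto)
  also have "\<dots> = \<i> * of_real (pi * (1 + 2 / (exp (2 * pi * y) - 1)) - 1 / y)"
  proof -
    define e where "e = exp (pi * y)"
    have e: "e > 1" using assms by (simp add: e_def)
    have e2: "exp (2 * pi * y) = e * e" by (simp add: e_def flip: exp_add)
    have "e * e > 1" using e by (metis less_1_mult)
    have *: "exp (\<i> * (of_real pi * w)) = of_real (inverse e)" "exp (- (\<i> * (of_real pi * w))) = of_real e"
      by (simp_all add: w_def e_def exp_minus exp_of_real algebra_simps flip: exp_of_real)
    have ne: "complex_of_real e \<noteq> 0" "(of_real e * of_real e - 1 :: complex) \<noteq> 0"
      using e \<open>e * e > 1\<close> by (simp, metis eq_iff_diff_eq_0 less_irrefl of_real_1 of_real_eq_iff of_real_mult)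
    have cs: "cos (of_real pi * w) = (of_real e * of_real e + 1) / (2 * of_real e)"
      unfolding cos_exp_eq * using ne(1) by (simp add: divide_simps)
    have sn: "sin (of_real pi * w) = \<i> * (of_real e * of_real e - 1) / (2 * of_real e)"
      unfolding sin_exp_eq * using ne(1) by (simp add: divide_simps) (simp add: algebra_simps)
    have "cos (of_real pi * w) / sin (of_real pi * w) =
        - \<i> * (of_real e * of_real e + 1) / (of_real e * of_real e - 1)"
      unfolding cs sn using ne by (simp add: divide_simps)
    also have "\<dots> = - \<i> * of_real (1 + 2 / (e * e - 1))"
      using ne(2) by (simp add: divide_simps flip: of_real_mult)
    finally have E1: "of_real pi * cos (of_real pi * w) / sin (of_real pi * w) =
        - \<i> * of_real pi * of_real (1 + 2 / (e * e - 1))"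
      unfolding times_divide_eq_right[symmetric] by simp
    have E2: "1 / w = - \<i> * of_real (1 / y)" by (simp add: w_def divide_simps)
    show ?thesis unfolding e2 E1 E2 by (simp add: algebra_simps)
  qed
  finally have "(\<lambda>n. \<i> * of_real (2 * y / ((real n + 1)\<^sup>2 + y\<^sup>2))) sums \<dots>" .
  \<comment> \<open>Both sides are \<open>\<i>\<close> times a real quantity, so the imaginary part
    is the claim.\<close>
  from sums_Im[OF this] show ?thesis by simp
qed

text \<open>The cotangent expansion at y = x / (2 pi), divided by 2 pi. Its positive terms yield the
  sign of \<open>bose_reg\<close>, its linear bound and its Mellin transform.\<close>

lemma bose_reg_sums:
  assumes "x > 0"
  shows "(\<lambda>n. 2 * x / (x\<^sup>2 + (2 * pi * real (Suc n))\<^sup>2)) sums bose_reg x"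
proof -
  define y where "y = x / (2 * pi)"
  have x: "x = 2 * pi * y" and y: "y > 0" using assms by (simp_all add: y_def)
  have "(\<lambda>n. 1 / (2 * pi) * (2 * y / ((real n + 1)\<^sup>2 + y\<^sup>2))) sums
      (1 / (2 * pi) * (pi * (1 + 2 / (exp (2 * pi * y) - 1)) - 1 / y))"
    by (intro sums_mult coth_partial_fractions y)
  also have "(\<lambda>n. 1 / (2 * pi) * (2 * y / ((real n + 1)\<^sup>2 + y\<^sup>2))) =
      (\<lambda>n. 2 * x / (x\<^sup>2 + (2 * pi * real (Suc n))\<^sup>2))"
  proof
    fix n
    have "x\<^sup>2 + (2 * pi * real (Suc n))\<^sup>2 = 4 * pi\<^sup>2 * ((real n + 1)\<^sup>2 + y\<^sup>2)"
      by (simp add: x power2_eq_square algebra_simps)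
    moreover have "(real n + 1)\<^sup>2 + y\<^sup>2 > 0" by (intro add_pos_pos) (use y in auto)
    moreover have "1 / (2 * pi) * (2 * y / D) = 2 * x / (4 * pi\<^sup>2 * D)" if "D > 0" for D
      using that by (simp add: x field_simps power2_eq_square)
    ultimately show "1 / (2 * pi) * (2 * y / ((real n + 1)\<^sup>2 + y\<^sup>2)) = 2 * x / (x\<^sup>2 + (2 * pi * real (Suc n))\<^sup>2)"
      by presburger
  qed
  also have "1 / (2 * pi) * (pi * (1 + 2 / (exp (2 * pi * y) - 1)) - 1 / y) = bose_reg x"
    by (simp add: bose_reg_def bose_def x field_simps)
  finally show ?thesis .
qed

lemma bose_reg_nonneg: "x > 0 \<Longrightarrow> 0 \<le> bose_reg x"
  by (rule sums_le[OF _ sums_zero bose_reg_sums]) auto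

text \<open>Dropping x^2 from each denominator leaves x times a convergent multiple of the series of
  1/n^2.\<close>

lemma bose_reg_le_linear: "\<exists>C\<ge>0. \<forall>x>0. bose_reg x \<le> C * x"
proof -
  let ?c = "\<lambda>n. 2 / (2 * pi)\<^sup>2 * (1 / real (Suc n)^2)"
  have "summable (\<lambda>n. 1 / real (Suc n)^2)"
    using inverse_power_summable[of 2] by (subst summable_Suc_iff) (simp add: field_simps)
  hence c: "summable ?c" by (rule summable_mult)
  have "bose_reg x \<le> suminf ?c * x" if "x > 0" for x
  proof (rule sums_le[OF _ bose_reg_sums[OF that] sums_mult2[OF summable_sums[OF c]]])
    fix n
    have "2 * x / (x\<^sup>2 + (2 * pi * real (Suc n))\<^sup>2) \<le> 2 * x / (2 * pi * real (Suc n))\<^sup>2"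
      using that by (intro divide_left_mono mult_pos_pos add_nonneg_pos) auto
    also have "\<dots> = ?c n * x" by (simp add: power_mult_distrib)
    finally show "2 * x / (x\<^sup>2 + (2 * pi * real (Suc n))\<^sup>2) \<le> ?c n * x" .
  qed
  thus ?thesis using suminf_nonneg[OF c] by (intro exI[of _ "suminf ?c"]) simp
qed

section \<open>Mellin transforms\<close>

text \<open>Over each compact interval \<open>{u n..v n}\<close> the Leibniz rule gives holomorphy
  in s. Since |x^(s-1)| depends only on Re s, \<open>G\<close> bounds the integrand for all s in the
  strip, so the omitted tails tend to 0 uniformly in s and holomorphy passes to the limit.\<close>

lemma holomorphic_on_Mellin_integral:
  fixes \<phi> G :: "real \<Rightarrow> real" and u v :: "nat \<Rightarrow> real"
  assumes S: "S \<subseteq> {0<..}" "S \<in> sets lebesgue" "\<And>n. {u n..v n} \<subseteq> S"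
    and ev: "\<And>x. x \<in> S \<Longrightarrow> \<forall>\<^sub>F n in sequentially. x \<in> {u n..v n}"
    and cont: "continuous_on S \<phi>"
    and G: "G integrable_on S"
    and bound: "\<And>x \<sigma>. x \<in> S \<Longrightarrow> a < \<sigma> \<Longrightarrow> \<sigma> < b \<Longrightarrow> \<bar>\<phi> x\<bar> * x powr (\<sigma> - 1) \<le> G x"
  shows "(\<lambda>s. integral S (\<lambda>x. of_real (\<phi> x) * of_real x powr (s - 1))) holomorphic_on {s. a < Re s \<and> Re s < b}"
    and "\<And>s. a < Re s \<Longrightarrow> Re s < b \<Longrightarrow> (\<lambda>x. of_real (\<phi> x) * of_real x powr (s - 1)) integrable_on S"
proof -
  define U where "U = {s. a < Re s \<and> Re s < b}"
  define f where "f = (\<lambda>s x. complex_of_real (\<phi> x) * of_real x powr (s - 1))"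
  have U: "open U" "convex U"
  proof -
    have "U = {s. a < Re s} \<inter> {s. Re s < b}" by (auto simp: U_def)
    thus "open U" "convex U"
      by (auto intro!: open_Int convex_Int open_halfspace_Re_gt open_halfspace_Re_lt
          convex_halfspace_Re_gt convex_halfspace_Re_lt)
  qed
  have le: "norm (f s x) \<le> G x" if "s \<in> U" "x \<in> S" for s x
    using bound[of x "Re s"] that S(1) by (auto simp: f_def U_def norm_mult norm_powr_real_powr)
  have contf: "continuous_on S (f s)" for s
    unfolding f_def using S(1) by (intro continuous_intros cont) auto
  have int: "f s integrable_on S" if "s \<in> U" for s
  proof (rule measurable_bounded_by_integrable_imp_integrable)
    show "f s \<in> borel_measurable (lebesgue_on S)"
      by (intro continuous_imp_measurable_on_sets_lebesgue contf S)
    show "\<And>x. x \<in> S \<Longrightarrow> norm (f s x) \<le> G x" using le[OF that] by auto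
  qed (use G S in auto)
  thus "\<And>s. a < Re s \<Longrightarrow> Re s < b \<Longrightarrow> (\<lambda>x. of_real (\<phi> x) * of_real x powr (s - 1)) integrable_on S"
    by (simp add: f_def U_def)
  define T where "T = (\<lambda>n. {u n..v n})"
  have G0: "G x \<ge> 0" if "x \<in> S" "s \<in> U" for x s
    using le[OF that(2,1)] norm_ge_zero order_trans by blast
  have GT: "G integrable_on T n" for n
    using integrable_on_subcbox[OF G, of "u n" "v n"] S(3) by (auto simp: T_def)
  have fT: "f s integrable_on T n" if "s \<in> U" for s n
    using integrable_on_subcbox[OF int[OF that], of "u n" "v n"] S(3) by (auto simp: T_def)
  have TS: "T n \<subseteq> S" "T n \<inter> S = T n" for n using S(3) by (auto simp: T_def)
  \<comment> \<open>The tail estimate: the right-hand side is free of s.\<close>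
  have dist_le: "norm (integral (T n) (f s) - integral S (f s)) \<le> integral S G - integral (T n) G"
    if s: "s \<in> U" for s n
  proof -
    have 1: "(\<lambda>x. if x \<in> T n then f s x else 0) integrable_on S"
        "integral S (\<lambda>x. if x \<in> T n then f s x else 0) = integral (T n) (f s)"
      using fT[OF s, of n] TS[of n]
      by (simp_all add: integrable_restrict_Int[of "T n" _ S] integral_restrict_Int[of S "T n"] Int_commute)
    have 2: "(\<lambda>x. if x \<in> T n then G x else 0) integrable_on S"
        "integral S (\<lambda>x. if x \<in> T n then G x else 0) = integral (T n) G"
      using GT[of n] TS[of n]
      by (simp_all add: integrable_restrict_Int[of "T n" _ S] integral_restrict_Int[of S "T n"] Int_commute)
    have "norm (integral S (\<lambda>x. f s x - (if x \<in> T n then f s x else 0)))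
        \<le> integral S (\<lambda>x. G x - (if x \<in> T n then G x else 0))"
      by (rule integral_norm_bound_integral) (use le[OF s] in \<open>auto intro!: integrable_diff int[OF s] G 1 2\<close>)
    thus ?thesis
      using integral_diff[OF int[OF s] 1(1)] integral_diff[OF G 2(1)] 1 2 by (simp add: norm_minus_commute)
  qed
  \<comment> \<open>The point s witnesses that the strip is nonempty, which makes \<open>G\<close>
    nonnegative through \<open>G0\<close>, so that \<open>G\<close> can dominate its own
    truncations.\<close>
  have lim: "(\<lambda>n. integral (T n) G) \<longlonglongrightarrow> integral S G" if s: "s \<in> U" for s
  proof -
    have "(\<lambda>n. integral S (\<lambda>x. if x \<in> T n then G x else 0)) \<longlonglongrightarrow> integral S G"
    proof (rule dominated_convergence)
      show "(\<lambda>x. if x \<in> T n then G x else 0) integrable_on S" for n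
        using GT[of n] TS[of n] by (simp add: integrable_restrict_Int[of "T n" _ S])
      show "(\<lambda>n. if x \<in> T n then G x else 0) \<longlonglongrightarrow> G x" if "x \<in> S" for x
        using ev[OF that] by (intro tendsto_eventually, elim eventually_mono) (simp add: T_def)
    qed (use G G0[OF _ s] in auto)
    thus ?thesis using TS by (simp add: integral_restrict_Int Int_commute)
  qed
  have "(\<lambda>s. integral S (f s)) holomorphic_on U"
  proof (rule holomorphic_uniform_sequence)
    show "open U" by fact
    fix n
    have "(\<lambda>s. integral (cbox (u n) (v n)) (f s)) holomorphic_on U"
    proof (rule leibniz_rule_holomorphic)
      fix s x assume "s \<in> U" "x \<in> cbox (u n) (v n)"
      hence x: "x > 0" "x \<in> S" using S(3)[of n] S(1) by auto
      show "((\<lambda>s. f s x) has_field_derivative (f s x * of_real (ln x))) (at s within U)"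
      proof -
        have "((\<lambda>s. of_real x powr (s - 1)) has_field_derivative
            Ln (of_real x) * of_real x powr (s - 1) * (1 - 0)) (at s within U)"
          using x by (intro DERIV_chain2[where f = "\<lambda>z. of_real x powr z"]
              has_field_derivative_powr_right DERIV_diff DERIV_ident DERIV_const) auto
        from DERIV_cmult[OF this, of "of_real (\<phi> x)"] show ?thesis
          unfolding f_def using x by (simp add: Ln_of_real mult_ac)
      qed
    next
      show "f s integrable_on cbox (u n) (v n)" if "s \<in> U" for s
        using fT[OF that] by (simp add: T_def)
      have "continuous_on (cbox (u n) (v n)) \<phi>"
        using cont S(3)[of n] by (auto intro: continuous_on_subset)
      have pos: "x > 0" if "u n \<le> x" "x \<le> v n" for x using that S(3)[of n] S(1) by auto
      have c1: "continuous_on (U \<times> cbox (u n) (v n)) (\<lambda>p. \<phi> (snd p))"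
        by (rule continuous_on_compose2[OF \<open>continuous_on (cbox (u n) (v n)) \<phi>\<close> continuous_on_snd]) auto
      have c2: "continuous_on (U \<times> cbox (u n) (v n)) (\<lambda>p. ln (snd p))"
        by (intro continuous_on_ln continuous_intros) (use pos in force)
      \<comment> \<open>Joint continuity is checked with the power written as exp((s - 1) ln x),
        which agrees with it because x > 0.\<close>
      have "continuous_on (U \<times> cbox (u n) (v n)) (\<lambda>p. of_real (\<phi> (snd p)) *
          exp ((fst p - 1) * of_real (ln (snd p))) * of_real (ln (snd p)))"
        by (intro continuous_intros c1 c2)
      thus "continuous_on (U \<times> cbox (u n) (v n)) (\<lambda>(s, x). f s x * of_real (ln x))"
        by (rule continuous_on_eq) (auto simp: f_def powr_def Ln_of_real[OF pos])
    qed (fact U)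
    thus "(\<lambda>s. integral (T n) (f s)) holomorphic_on U" by (simp add: T_def)
  next
    fix s assume s: "s \<in> U"
    obtain d where d: "d > 0" "cball s d \<subseteq> U" using U(1) s unfolding open_contains_cball by blast
    have "uniform_limit (cball s d) (\<lambda>n s. integral (T n) (f s)) (\<lambda>s. integral S (f s)) sequentially"
    proof (rule uniform_limitI)
      fix e :: real assume "e > 0"
      have "\<forall>\<^sub>F n in sequentially. dist (integral (T n) G) (integral S G) < e"
        by (rule tendstoD[OF lim[OF s] \<open>e > 0\<close>])
      thus "\<forall>\<^sub>F n in sequentially. \<forall>s\<in>cball s d. dist (integral (T n) (f s)) (integral S (f s)) < e"
      proof eventually_elim
        case (elim n)
        show ?case
        proof
          fix t assume "t \<in> cball s d"
          hence "t \<in> U" using d by auto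
          thus "dist (integral (T n) (f t)) (integral S (f t)) < e"
            using dist_le[of t n] elim by (simp add: dist_norm)
        qed
      qed
    qed
    thus "\<exists>d>0. cball s d \<subseteq> U \<and> uniform_limit (cball s d) (\<lambda>n s. integral (T n) (f s)) (\<lambda>s. integral S (f s)) sequentially"
      using d by blast
  qed
  thus "(\<lambda>s. integral S (\<lambda>x. of_real (\<phi> x) * of_real x powr (s - 1))) holomorphic_on {s. a < Re s \<and> Re s < b}"
    by (simp add: f_def U_def)
qed

section \<open>Termwise integration and substitution for nonnegative integrands\<close>

lemma has_integral_sums_nonneg:
  fixes f :: "nat \<Rightarrow> real \<Rightarrow> real"
  assumes "\<And>n. (f n has_integral I n) S" "\<And>n x. x \<in> S \<Longrightarrow> f n x \<ge> 0"
    and "\<And>x. x \<in> S \<Longrightarrow> (\<lambda>n. f n x) sums g x" "I sums J"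
  shows "(g has_integral J) S"
proof (rule has_integral_monotone_convergence_increasing)
  show "((\<lambda>x. \<Sum>i<n. f i x) has_integral (\<Sum>i<n. I i)) S" for n
    by (intro has_integral_sum assms) auto
qed (use assms in \<open>auto simp: sums_def\<close>)

text \<open>Nonnegativity upgrades integrability to absolute integrability, which the change of
  variables theorem works with.\<close>

lemma has_integral_substitution_nonneg:
  fixes f g :: "real \<Rightarrow> real"
  assumes "S \<in> sets lebesgue"
    and "\<And>x. x \<in> S \<Longrightarrow> (g has_field_derivative g' x) (at x within S)" "inj_on g S"
    and I: "(f has_integral I) (g ` S)" and "\<And>y. y \<in> g ` S \<Longrightarrow> f y \<ge> 0"
  shows "((\<lambda>x. \<bar>g' x\<bar> * f (g x)) has_integral I) S"
proof -
  have "f absolutely_integrable_on (g ` S) \<and> integral (g ` S) f = I"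
    using assms(5) I by (auto intro!: nonnegative_absolutely_integrable_1 simp: has_integral_iff)
  hence "(\<lambda>x. \<bar>g' x\<bar> * f (g x)) absolutely_integrable_on S \<and> integral S (\<lambda>x. \<bar>g' x\<bar> * f (g x)) = I"
    using has_absolute_integral_change_of_variables_1'[OF assms(1-3), of f I] by simp
  thus ?thesis using set_lebesgue_integral_eq_integral(1) by (auto simp: has_integral_iff)
qed

lemma has_integral_Gamma_scaled:
  fixes s c :: real
  assumes "s > 0" "c > 0"
  shows "((\<lambda>x. exp (- (c * x)) * x powr (s - 1)) has_integral (Gamma s * c powr (-s))) {0<..}"
proof -
  have img: "(\<lambda>x. c * x) ` {0<..} = {0<..}"
  proof (intro equalityI subsetI)
    fix y :: real assume "y \<in> {0<..}"
    thus "y \<in> (\<lambda>x. c * x) ` {0<..}" using assms by (intro image_eqI[of _ _ "y / c"]) auto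
  qed (use assms in auto)
  have "((\<lambda>t. t powr (s - 1) / exp t) has_integral Gamma s) {0<..}"
    by (rule has_integral_spike_set_eq[THEN iffD1, OF _ _ Gamma_integral_real[OF assms(1)]])
       (auto intro: negligible_subset[of "{0}"])
  hence "((\<lambda>x. \<bar>c\<bar> * ((c * x) powr (s - 1) / exp (c * x))) has_integral Gamma s) {0<..}"
    using assms by (intro has_integral_substitution_nonneg)
      (auto intro!: derivative_eq_intros simp: inj_on_def img)
  from has_integral_mult_right[OF this, of "c powr (-s)"]
  have "((\<lambda>x. c powr (-s) * (\<bar>c\<bar> * ((c * x) powr (s - 1) / exp (c * x)))) has_integral (c powr (-s) * Gamma s)) {0<..}" .
  moreover have "c powr (-s) * (\<bar>c\<bar> * ((c * x) powr (s - 1) / exp (c * x))) = exp (- (c * x)) * x powr (s - 1)"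
    if "x > 0" for x
  proof -
    have "c powr (-s) * c * c powr (s - 1) = 1"
      using assms by (simp add: powr_diff powr_minus)
    thus ?thesis using that assms by (simp add: powr_mult exp_minus divide_simps)
  qed
  ultimately have "((\<lambda>x. exp (- (c * x)) * x powr (s - 1)) has_integral (c powr (-s) * Gamma s)) {0<..}"
    by (rule has_integral_eq[rotated]) auto
  thus ?thesis by (simp only: mult.commute)
qed

section \<open>Mellin transforms of the two kernels at real arguments\<close>

lemma bose_sums:
  assumes "x > 0"
  shows "(\<lambda>n. exp (- (real (Suc n) * x))) sums bose x"
proof -
  have "(\<lambda>n. exp (-x) * exp (-x) ^ n) sums (exp (-x) * (1 / (1 - exp (-x))))"
    by (intro sums_mult geometric_sums) (use assms in auto)
  also have "(\<lambda>n. exp (-x) * exp (-x) ^ n) = (\<lambda>n. exp (- (real (Suc n) * x)))"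
    by (simp add: exp_of_nat_mult[symmetric] exp_add[symmetric] algebra_simps)
  also have "exp (-x) * (1 / (1 - exp (-x))) = bose x"
    using assms by (simp add: bose_def exp_minus field_simps)
  finally show ?thesis .
qed

text \<open>Links the real-valued integrals below to complex identities: at real s > 1 the value of
  \<open>zeta_lim\<close> is real.\<close>

lemma zeta_lim_of_real:
  assumes "s > (1::real)"
  shows "(\<lambda>n. real (Suc n) powr (-s)) sums Re (zeta_lim (of_real s))"
    and "of_real (Re (zeta_lim (of_real s))) = zeta_lim (of_real s)"
proof -
  have 1: "(\<lambda>n. of_nat (Suc n) powr (- complex_of_real s)) sums zeta_lim (of_real s)"
    by (rule sums_zeta_lim) (use assms in auto)
  have 2: "of_nat (Suc n) powr (- complex_of_real s) = of_real (real (Suc n) powr (-s))" for n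
    by (metis of_nat_0_le_iff of_real_minus of_real_of_nat_eq powr_of_real)
  have 3: "(\<lambda>n. complex_of_real (real (Suc n) powr (-s))) sums zeta_lim (of_real s)"
    using 1 by (simp only: 2)
  from sums_Re[OF this] show r: "(\<lambda>n. real (Suc n) powr (-s)) sums Re (zeta_lim (of_real s))"
    by simp
  show "of_real (Re (zeta_lim (of_real s))) = zeta_lim (of_real s)"
    by (rule sums_unique2[OF sums_of_real[OF r] 3])
qed

text \<open>The classical formula for Gamma(s) zeta(s): expand \<open>bose\<close> as a geometric
  series in exp(-x) and integrate term by term.\<close>

lemma has_integral_bose:
  assumes "s > (1::real)"
  shows "((\<lambda>x. bose x * x powr (s - 1)) has_integral (Gamma s * Re (zeta_lim (of_real s)))) {0<..}"
proof (rule has_integral_sums_nonneg)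
  show "((\<lambda>x. exp (- (real (Suc n) * x)) * x powr (s - 1)) has_integral Gamma s * real (Suc n) powr (-s)) {0<..}" for n
    by (rule has_integral_Gamma_scaled) (use assms in auto)
  show "(\<lambda>n. exp (- (real (Suc n) * x)) * x powr (s - 1)) sums (bose x * x powr (s - 1))" if "x \<in> {0<..}" for x
    by (intro sums_mult2 bose_sums) (use that in auto)
  show "(\<lambda>n. Gamma s * real (Suc n) powr (-s)) sums (Gamma s * Re (zeta_lim (of_real s)))"
    by (intro sums_mult zeta_lim_of_real assms)
qed auto

text \<open>The substitution t = x^2 / (x^2 + c^2) produces a Beta integral with parameters a = (1 +
  s)/2 and b = (1 - s)/2, both positive for -1 < s < 1. As a + b = 1, it equals Gamma(a) Gamma(1 -
  a) = pi / sin(pi a) = pi / cos(pi s / 2).\<close>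

lemma has_integral_powr_over_quadratic:
  fixes s c :: real
  assumes "-1 < s" "s < 1" "c > 0"
  shows "((\<lambda>x. 2 * x / (x\<^sup>2 + c\<^sup>2) * x powr (s - 1)) has_integral (pi / cos (pi * s / 2) * c powr (s - 1))) {0<..}"
proof -
  define a b where "a = (1 + s) / 2" and "b = (1 - s) / 2"
  have ab: "a > 0" "b > 0" using assms by (auto simp: a_def b_def)
  define g where "g = (\<lambda>x. x\<^sup>2 / (x\<^sup>2 + c\<^sup>2))"
  define g' where "g' = (\<lambda>x. 2 * x * c\<^sup>2 / (x\<^sup>2 + c\<^sup>2)\<^sup>2)"
  define f where "f = (\<lambda>t. t powr (a - 1) * (1 - t) powr (b - 1))"
  have pos: "x\<^sup>2 + c\<^sup>2 > 0" for x :: real by (intro add_nonneg_pos) (use assms in auto)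
  have 1: "1 - g x = c\<^sup>2 / (x\<^sup>2 + c\<^sup>2)" for x
    using less_imp_neq[OF pos[of x]] by (simp add: g_def diff_divide_eq_iff)
  have g01: "0 < g x" "g x < 1" if "x > 0" for x
    using pos[of x] that assms by (auto simp: g_def field_simps)
  have img: "g ` {0<..} = {0<..<1}"
  proof (intro equalityI subsetI)
    fix t :: real assume t: "t \<in> {0<..<1}"
    \<comment> \<open>Obtained by solving t = x^2 / (x^2 + c^2) for x.\<close>
    define x where "x = c * sqrt (t / (1 - t))"
    have "x > 0" "x\<^sup>2 = c\<^sup>2 * (t / (1 - t))" using t assms by (auto simp: x_def power_mult_distrib)
    moreover have "g x = t" unfolding g_def \<open>x\<^sup>2 = _\<close> using t assms by (simp add: field_simps)
    ultimately show "t \<in> g ` {0<..}" by force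
  qed (use g01 in auto)
  have inj: "inj_on g {0<..}"
  proof (rule inj_onI)
    fix x y assume "x \<in> {0<..}" "y \<in> {0<..}" "g x = g y"
    hence "c\<^sup>2 / (x\<^sup>2 + c\<^sup>2) = c\<^sup>2 / (y\<^sup>2 + c\<^sup>2)" using 1 by metis
    hence "x\<^sup>2 = y\<^sup>2" using pos[of x] pos[of y] assms by (simp add: field_simps)
    thus "x = y" using \<open>x \<in> _\<close> \<open>y \<in> _\<close> by (simp add: power2_eq_iff_nonneg)
  qed
  have Beta: "(f has_integral Beta a b) {0<..<1}"
    by (rule has_integral_spike_set_eq[THEN iffD1, OF _ _ has_integral_Beta_real[OF ab, folded f_def]])
       (auto intro: negligible_subset[of "{0, 1}"])
  have "((\<lambda>x. \<bar>g' x\<bar> * f (g x)) has_integral Beta a b) {0<..}"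
  proof (rule has_integral_substitution_nonneg[where f = f and g = g and g' = g'])
    fix x :: real assume "x \<in> {0<..}"
    have "(g has_field_derivative ((2 * x) * (x\<^sup>2 + c\<^sup>2) - x\<^sup>2 * (2 * x)) / (x\<^sup>2 + c\<^sup>2)\<^sup>2) (at x within {0<..})"
      unfolding g_def using pos[of x] by (auto intro!: derivative_eq_intros simp: power2_eq_square)
    thus "(g has_field_derivative g' x) (at x within {0<..})"
      by (simp add: g'_def algebra_simps)
  qed (use Beta in \<open>auto simp: img f_def inj\<close>)
  from has_integral_mult_right[OF this, of "c powr (s - 1)"]
  have I: "((\<lambda>x. c powr (s - 1) * (\<bar>g' x\<bar> * f (g x))) has_integral c powr (s - 1) * Beta a b) {0<..}" .
  have "Beta a b = pi / cos (pi * s / 2)"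
  proof -
    have "b = 1 - a" "a + b = 1" by (simp_all add: a_def b_def field_simps)
    hence "Beta a b = Gamma a * Gamma (1 - a)" by (simp only: Beta_def) simp
    also have "\<dots> = pi / sin (pi * a)"
    proof -
      have "complex_of_real (Gamma a * Gamma (1 - a)) = Gamma (of_real a) * Gamma (1 - of_real a)"
        by (simp flip: Gamma_complex_of_real)
      also have "\<dots> = of_real (pi / sin (pi * a))"
        unfolding Gamma_reflection_complex by (simp flip: sin_of_real)
      finally show ?thesis unfolding of_real_eq_iff .
    qed
    also have "pi * a = pi / 2 + pi * s / 2" by (simp add: a_def field_simps)
    also have "sin \<dots> = cos (pi * s / 2)" by (simp add: sin_add)
    finally show ?thesis .
  qed
  moreover have "c powr (s - 1) * (\<bar>g' x\<bar> * f (g x)) = 2 * x / (x\<^sup>2 + c\<^sup>2) * x powr (s - 1)" if x: "x > 0" for x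
  proof -
    define q where "q = x\<^sup>2 + c\<^sup>2"
    have q: "q > 0" using pos[of x] by (simp add: q_def)
    have sq: "z\<^sup>2 powr e = z powr (2 * e)" if "z > 0" for z e :: real
      using that by (simp add: powr_powr flip: powr_numeral)
    \<comment> \<open>The last equation merges the two powers of \<open>q\<close> in
      \<open>f (g x)\<close> into one factor \<open>q\<close>; against the \<open>q\<^sup>2\<close>
      under \<open>g'\<close> this leaves the single denominator of the integrand.\<close>
    have e: "2 * (a - 1) = s - 1" "2 * (b - 1) = - 1 - s" "(a - 1) + (b - 1) = -1"
      by (simp_all add: a_def b_def field_simps)
    have "f (g x) = x\<^sup>2 powr (a - 1) / q powr (a - 1) * ((c\<^sup>2) powr (b - 1) / q powr (b - 1))"
      unfolding f_def 1 unfolding g_def q_def[symmetric] using x q assms by (simp add: powr_divide)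
    also have "\<dots> = x powr (s - 1) * c powr (-1 - s) / (q powr (a - 1) * q powr (b - 1))"
      unfolding sq[OF x] sq[OF assms(3)] e by simp
    also have "q powr (a - 1) * q powr (b - 1) = inverse q"
      using q unfolding powr_add[symmetric] e by (simp add: powr_minus)
    finally have "f (g x) = x powr (s - 1) * c powr (-1 - s) * q" by (simp add: divide_inverse)
    moreover have "\<bar>g' x\<bar> = 2 * x * c\<^sup>2 / q\<^sup>2" using x assms q by (simp add: g'_def q_def[symmetric])
    ultimately have "c powr (s - 1) * (\<bar>g' x\<bar> * f (g x)) =
        2 * x / q * x powr (s - 1) * (c powr (s - 1) * c powr (-1 - s) * c\<^sup>2)"
      using q by (simp add: power2_eq_square field_simps)
    also have "c powr (s - 1) * c powr (-1 - s) * c\<^sup>2 = 1"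
      using assms by (simp add: powr_add[symmetric] powr_minus)
    finally show ?thesis by (simp add: q_def)
  qed
  ultimately show ?thesis
    using has_integral_eq[OF _ I, of "\<lambda>x. 2 * x / (x\<^sup>2 + c\<^sup>2) * x powr (s - 1)"] by (simp add: mult.commute)
qed

text \<open>Each term of \<open>bose_reg_sums\<close> contributes a multiple of (2 pi n)^(s-1).
  Summation over n gives zeta(1 - s), and s < 0 puts 1 - s into the region of convergence.\<close>

lemma has_integral_bose_reg:
  fixes s :: real
  assumes "-1 < s" "s < 0"
  shows "((\<lambda>x. bose_reg x * x powr (s - 1)) has_integral
    (pi / cos (pi * s / 2) * (2 * pi) powr (s - 1) * Re (zeta_lim (of_real (1 - s))))) {0<..}"
proof (rule has_integral_sums_nonneg)
  let ?c = "pi / cos (pi * s / 2)"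
  show "((\<lambda>x. 2 * x / (x\<^sup>2 + (2 * pi * real (Suc n))\<^sup>2) * x powr (s - 1)) has_integral
      ?c * (2 * pi * real (Suc n)) powr (s - 1)) {0<..}" for n
    by (rule has_integral_powr_over_quadratic) (use assms in auto)
  show "(\<lambda>n. 2 * x / (x\<^sup>2 + (2 * pi * real (Suc n))\<^sup>2) * x powr (s - 1)) sums (bose_reg x * x powr (s - 1))"
    if "x \<in> {0<..}" for x
    by (intro sums_mult2 bose_reg_sums) (use that in auto)
  have "(\<lambda>n. ?c * (2 * pi) powr (s - 1) * real (Suc n) powr (- (1 - s))) sums
      (?c * (2 * pi) powr (s - 1) * Re (zeta_lim (of_real (1 - s))))"
    by (intro sums_mult zeta_lim_of_real) (use assms in auto)
  moreover have "?c * (2 * pi) powr (s - 1) * real (Suc n) powr (- (1 - s)) =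
      ?c * (2 * pi * real (Suc n)) powr (s - 1)" for n
    by (subst powr_mult) auto
  ultimately show "(\<lambda>n. ?c * (2 * pi * real (Suc n)) powr (s - 1)) sums
      (?c * (2 * pi) powr (s - 1) * Re (zeta_lim (of_real (1 - s))))"
    by (simp only:)
qed auto

section \<open>Splitting the Mellin integral at 1\<close>

text \<open>The crux of the continuation: integrating x^(s-1) over (0,1] for s > 0 and over [1,oo)
  for s < 0 gives the same rational function up to sign. Hence adding 1/x - 1/2 back on (0,1] and
  subtracting it on [1,oo) lead to the same expression \<open>Mellin_sum\<close>.\<close>

lemma has_integral_powr_complex:
  fixes s :: complex
  assumes "s \<in> \<real>"
  shows "Re s > 0 \<Longrightarrow> ((\<lambda>x. of_real x powr (s - 1)) has_integral 1 / s) {0<..1}"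
    and "Re s < 0 \<Longrightarrow> ((\<lambda>x. of_real x powr (s - 1)) has_integral - 1 / s) {1..}"
proof -
  obtain t where s: "s = of_real t" using assms by (auto elim: Reals_cases)
  have eq: "of_real (x powr (t - 1)) = complex_of_real x powr (s - 1)" if "x > 0" for x
    using that powr_of_real[of x "t - 1"] by (simp add: s)
  {
    assume "Re s > 0"
    hence "((\<lambda>x. x powr (t - 1)) has_integral 1 / t) {0..1}"
      using has_integral_powr_from_0[of "t - 1" 1] by (simp add: s)
    hence "((\<lambda>x. x powr (t - 1)) has_integral 1 / t) {0<..1}"
      by (rule has_integral_spike_set_eq[THEN iffD1, rotated 2]) (auto intro: negligible_subset[of "{0}"])
    from has_integral_linear[OF this bounded_linear_of_real[where 'a = complex]]
    have "((\<lambda>x. of_real (x powr (t - 1))) has_integral 1 / s) {0<..1}" by (simp add: o_def s)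
    thus "((\<lambda>x. of_real x powr (s - 1)) has_integral 1 / s) {0<..1}"
      by (rule has_integral_eq[rotated]) (auto simp: eq)
  next
    assume "Re s < 0"
    hence "((\<lambda>x. x powr (t - 1)) has_integral - 1 / t) {1..}"
      using has_integral_powr_to_inf[of "t - 1" 1] by (simp add: s)
    from has_integral_linear[OF this bounded_linear_of_real[where 'a = complex]]
    have "((\<lambda>x. of_real (x powr (t - 1))) has_integral - 1 / s) {1..}" by (simp add: o_def s)
    thus "((\<lambda>x. of_real x powr (s - 1)) has_integral - 1 / s) {1..}"
      by (rule has_integral_eq[rotated]) (auto simp: eq)
  }
qed

lemma has_integral_split_at_1:
  fixes f :: "real \<Rightarrow> 'a :: banach"
  assumes "(f has_integral i) {0<..1}" "(f has_integral j) {1..}"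
  shows "(f has_integral (i + j)) {0<..}"
proof -
  have "{0<..1} \<inter> {1..} = {1::real}" "{0<..1} \<union> {1..} = {0::real<..}" by auto
  with has_integral_Un[OF assms] show ?thesis by simp
qed

definition Mellin_low :: "complex \<Rightarrow> complex" where
  "Mellin_low s = integral {0<..1} (\<lambda>x. of_real (bose_reg x) * of_real x powr (s - 1))"

definition Mellin_high :: "complex \<Rightarrow> complex" where
  "Mellin_high s = integral {1..} (\<lambda>x. of_real (bose x) * of_real x powr (s - 1))"

text \<open>For x in (0,1] the linear bound on \<open>bose_reg\<close> gives the majorant C x^a
  throughout the strip, and it is integrable because a > -1.\<close>

lemma Mellin_low_strip:
  assumes "-1 < a"
  shows "Mellin_low holomorphic_on {s. a < Re s \<and> Re s < b}"
    and "\<And>s. a < Re s \<Longrightarrow> Re s < b \<Longrightarrow>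
      ((\<lambda>x. of_real (bose_reg x) * of_real x powr (s - 1)) has_integral Mellin_low s) {0<..1}"
proof -
  obtain C where C: "C \<ge> 0" "\<And>x. x > 0 \<Longrightarrow> bose_reg x \<le> C * x" using bose_reg_le_linear by blast
  have "(\<lambda>x. x powr a) integrable_on {0<..1}"
    using integrable_on_powr_from_0[of a 1] assms
    by (subst integrable_spike_set_eq[of _ "{0..1}"]) (auto intro: negligible_subset[of "{0}"])
  hence G: "(\<lambda>x. C * x powr a) integrable_on {0<..1}" by (rule integrable_on_mult_right)
  have ev: "\<forall>\<^sub>F n in sequentially. x \<in> {1 / real (Suc n)..1}" if "x \<in> {0<..1}" for x
  proof -
    have "(\<lambda>n. 1 / real (Suc n)) \<longlonglongrightarrow> 0" using LIMSEQ_inverse_real_of_nat by (simp add: inverse_eq_divide)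
    hence "\<forall>\<^sub>F n in sequentially. 1 / real (Suc n) < x" using that by (auto dest: order_tendstoD(2))
    thus ?thesis using that by (auto elim: eventually_mono)
  qed
  have cont: "continuous_on {0<..1} bose_reg"
    unfolding bose_reg_def[abs_def] bose_def by (intro continuous_intros) auto
  have bound: "\<bar>bose_reg x\<bar> * x powr (\<sigma> - 1) \<le> C * x powr a" if "x \<in> {0<..1}" "a < \<sigma>" for x \<sigma>
  proof -
    have "\<bar>bose_reg x\<bar> * x powr (\<sigma> - 1) \<le> C * x * x powr (\<sigma> - 1)"
      using C(2)[of x] bose_reg_nonneg[of x] that by (intro mult_right_mono) auto
    also have "\<dots> = C * x powr \<sigma>" using that by (simp add: powr_diff)
    also have "\<dots> \<le> C * x powr a" using that C(1) by (intro mult_left_mono powr_mono') auto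
    finally show ?thesis .
  qed
  have sub: "{1 / real (Suc n)..1} \<subseteq> {0<..1}" for n
  proof
    fix x assume "x \<in> {1 / real (Suc n)..1}"
    moreover have "0 < 1 / real (Suc n)" by simp
    ultimately have "0 < x" "x \<le> 1" by (simp_all only: atLeastAtMost_iff) linarith
    thus "x \<in> {0<..1}" by simp
  qed
  note * = holomorphic_on_Mellin_integral[OF _ _ sub ev cont G bound, where b = b]
  show "Mellin_low holomorphic_on {s. a < Re s \<and> Re s < b}"
    unfolding Mellin_low_def[abs_def] by (rule *(1)) auto
  show "((\<lambda>x. of_real (bose_reg x) * of_real x powr (s - 1)) has_integral Mellin_low s) {0<..1}"
    if "a < Re s" "Re s < b" for s
    unfolding Mellin_low_def by (intro integrable_integral *(2)) (use that in auto)
qed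

text \<open>The exponential decay of \<open>bose\<close> beats every power of x, so \<open>a\<close>
  and \<open>b\<close> are arbitrary; the majorant is twice a Gamma integrand.\<close>

lemma Mellin_high_strip:
  shows "Mellin_high holomorphic_on {s. a < Re s \<and> Re s < b}"
    and "\<And>s. a < Re s \<Longrightarrow> Re s < b \<Longrightarrow>
      ((\<lambda>x. of_real (bose x) * of_real x powr (s - 1)) has_integral Mellin_high s) {1..}"
proof -
  \<comment> \<open>The maximum with 1 keeps the Gamma integral convergent at 0 even for nonpositive
    \<open>b\<close>.\<close>
  define c where "c = max b 1"
  have "(\<lambda>x. x powr (c - 1) / exp x) absolutely_integrable_on {0..}"
    using has_integral_integrable[OF Gamma_integral_real[of c]]
    by (intro nonnegative_absolutely_integrable_1) (auto simp: c_def)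
  hence "(\<lambda>x. x powr (c - 1) / exp x) absolutely_integrable_on {1..}"
    by (rule set_integrable_subset) auto
  hence "(\<lambda>x. x powr (c - 1) / exp x) integrable_on {1..}"
    by (rule set_lebesgue_integral_eq_integral)
  hence G: "(\<lambda>x. 2 * (x powr (c - 1) / exp x)) integrable_on {1..}" by (rule integrable_on_mult_right)
  have ev: "\<forall>\<^sub>F n in sequentially. x \<in> {1..real n}" if "x \<in> {1..}" for x
    using that eventually_ge_at_top[of "nat \<lceil>x\<rceil>"] by (auto elim!: eventually_mono)
  have cont: "continuous_on {1..} bose"
    unfolding bose_def[abs_def] by (intro continuous_intros) auto
  have bound: "\<bar>bose x\<bar> * x powr (\<sigma> - 1) \<le> 2 * (x powr (c - 1) / exp x)" if "x \<in> {1..}" "\<sigma> < b" for x \<sigma>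
  proof -
    have "exp x \<ge> 2" using that exp_ge_add_one_self[of x] by (simp only: atLeast_iff)
    hence "1 / (exp x - 1) \<le> 1 / (exp x / 2)" by (intro frac_le) simp_all
    moreover have "0 \<le> 1 / (exp x - 1)" using that by simp
    ultimately have "\<bar>1 / (exp x - 1)\<bar> \<le> 1 / (exp x / 2)" by (simp only: abs_of_nonneg)
    hence "\<bar>bose x\<bar> \<le> 2 / exp x" by (simp add: bose_def)
    moreover have "x powr (\<sigma> - 1) \<le> x powr (c - 1)" using that by (intro powr_mono) (auto simp: c_def)
    ultimately have "\<bar>bose x\<bar> * x powr (\<sigma> - 1) \<le> 2 / exp x * x powr (c - 1)" by (intro mult_mono) auto
    thus ?thesis by simp
  qed
  note * = holomorphic_on_Mellin_integral[OF _ _ _ ev cont G bound, where b = b]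
  show "Mellin_high holomorphic_on {s. a < Re s \<and> Re s < b}"
    unfolding Mellin_high_def[abs_def] by (rule *(1)) auto
  show "((\<lambda>x. of_real (bose x) * of_real x powr (s - 1)) has_integral Mellin_high s) {1..}"
    if "a < Re s" "Re s < b" for s
    unfolding Mellin_high_def by (intro integrable_integral *(2)) (use that in auto)
qed

lemma holomorphic_on_Mellin:
  "Mellin_low holomorphic_on {s. Re s > -1}" "Mellin_high holomorphic_on {s. Re s > -1}"
proof -
  have U: "{s. Re s > -1} = (\<Union>p\<in>{-1<..} \<times> UNIV. {s. fst p < Re s \<and> Re s < snd p})"
  proof (intro equalityI subsetI)
    fix s assume "s \<in> {s. Re s > -1}"
    thus "s \<in> (\<Union>p\<in>{-1<..} \<times> UNIV. {s. fst p < Re s \<and> Re s < snd p})"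
      \<comment> \<open>The left edge is the midpoint of -1 and Re s.\<close>
      by (intro UN_I[of "((Re s - 1) / 2, Re s + 1)"]) auto
  qed auto
  have op: "open {s. a < Re s \<and> Re s < b}" for a b :: real
    by (intro open_Collect_conj open_halfspace_Re_gt open_halfspace_Re_lt)
  show "Mellin_low holomorphic_on {s. Re s > -1}"
    unfolding U by (rule holomorphic_on_UN_open[OF Mellin_low_strip(1) op]) auto
  show "Mellin_high holomorphic_on {s. Re s > -1}"
    unfolding U by (rule holomorphic_on_UN_open[OF Mellin_high_strip(1) op])
qed

text \<open>The continuation of Gamma(s) zeta(s). The rational terms are the integral of (1/x - 1/2)
  x^(s-1) over (0,1], evaluated for Re s > 1.\<close>

definition Mellin_sum :: "complex \<Rightarrow> complex" where
  "Mellin_sum s = Mellin_low s + Mellin_high s + 1 / (s - 1) - 1 / (2 * s)"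

lemma Mellin_sum_gt_1:
  assumes "s > (1::real)"
  shows "Mellin_sum (of_real s) = Gamma (of_real s) * zeta_lim (of_real s)"
proof -
  let ?s = "complex_of_real s"
  have "((\<lambda>x. of_real (bose x * x powr (s - 1))) has_integral complex_of_real (Gamma s * Re (zeta_lim ?s))) {0<..}"
    using has_integral_linear[OF has_integral_bose[OF assms] bounded_linear_of_real[where 'a = complex]]
    by (simp add: o_def)
  hence 1: "((\<lambda>x. of_real (bose x) * of_real x powr (?s - 1)) has_integral
      of_real (Gamma s * Re (zeta_lim ?s))) {0<..}"
    by (rule has_integral_eq[rotated]) (use powr_of_real[of _ "s - 1"] in auto)
  have p1: "((\<lambda>x. of_real x powr (?s - 1 - 1)) has_integral 1 / (?s - 1)) {0<..1}"
    by (rule has_integral_powr_complex) (use assms in auto)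
  have p2: "((\<lambda>x. of_real x powr (?s - 1)) has_integral 1 / ?s) {0<..1}"
    by (rule has_integral_powr_complex) (use assms in auto)
  have "((\<lambda>x. of_real (bose_reg x) * of_real x powr (?s - 1)) has_integral Mellin_low ?s) {0<..1}"
    by (rule Mellin_low_strip(2)[of 0 _ "s + 1"]) (use assms in auto)
  from has_integral_diff[OF has_integral_add[OF this p1] has_integral_mult_right[OF p2, of "1/2"]]
  have "((\<lambda>x. of_real (bose x) * of_real x powr (?s - 1)) has_integral
      (Mellin_low ?s + 1 / (?s - 1) - 1 / 2 * (1 / ?s))) {0<..1}"
    by (rule has_integral_eq[rotated]) (auto simp: bose_reg_def powr_diff power2_eq_square algebra_simps)
  moreover have "((\<lambda>x. of_real (bose x) * of_real x powr (?s - 1)) has_integral Mellin_high ?s) {1..}"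
    by (rule Mellin_high_strip(2)[of 0 _ "s + 1"]) (use assms in auto)
  ultimately have 2: "((\<lambda>x. of_real (bose x) * of_real x powr (?s - 1)) has_integral
      (Mellin_low ?s + 1 / (?s - 1) - 1 / 2 * (1 / ?s) + Mellin_high ?s)) {0<..}"
    by (rule has_integral_split_at_1)
  have "complex_of_real (Gamma s * Re (zeta_lim ?s)) = Gamma ?s * zeta_lim ?s"
    by (simp add: zeta_lim_of_real(2)[OF assms] Gamma_complex_of_real)
  with has_integral_unique[OF 1 2] show ?thesis by (simp add: Mellin_sum_def algebra_simps)
qed

text \<open>For negative s the rational terms are absorbed on [1,oo) instead, turning
  \<open>bose\<close> into \<open>bose_reg\<close> there, so the two pieces join to the Mellin
  transform of \<open>bose_reg\<close> over the whole half line.\<close>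

lemma Mellin_sum_neg:
  assumes "-1 < s" "s < (0::real)"
  shows "Mellin_sum (of_real s) = of_real pi / cos (of_real pi * of_real s / 2) *
    of_real (2 * pi) powr (of_real s - 1) * zeta_lim (1 - of_real s)"
proof -
  let ?s = "complex_of_real s"
  let ?I = "pi / cos (pi * s / 2) * (2 * pi) powr (s - 1) * Re (zeta_lim (of_real (1 - s)))"
  have "((\<lambda>x. of_real (bose_reg x * x powr (s - 1))) has_integral complex_of_real ?I) {0<..}"
    using has_integral_linear[OF has_integral_bose_reg[OF assms] bounded_linear_of_real[where 'a = complex]]
    by (simp add: o_def)
  hence 1: "((\<lambda>x. of_real (bose_reg x) * of_real x powr (?s - 1)) has_integral complex_of_real ?I) {0<..}"
    by (rule has_integral_eq[rotated]) (use powr_of_real[of _ "s - 1"] in auto)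
  have p1: "((\<lambda>x. of_real x powr (?s - 1 - 1)) has_integral - 1 / (?s - 1)) {1..}"
    by (rule has_integral_powr_complex) (use assms in auto)
  have p2: "((\<lambda>x. of_real x powr (?s - 1)) has_integral - 1 / ?s) {1..}"
    by (rule has_integral_powr_complex) (use assms in auto)
  have "((\<lambda>x. of_real (bose x) * of_real x powr (?s - 1)) has_integral Mellin_high ?s) {1..}"
    by (rule Mellin_high_strip(2)[of "-1" _ 0]) (use assms in auto)
  from has_integral_add[OF has_integral_diff[OF this p1] has_integral_mult_right[OF p2, of "1/2"]]
  have "((\<lambda>x. of_real (bose_reg x) * of_real x powr (?s - 1)) has_integral
      (Mellin_high ?s - (- 1 / (?s - 1)) + 1 / 2 * (- 1 / ?s))) {1..}"
    by (rule has_integral_eq[rotated]) (auto simp: bose_reg_def powr_diff power2_eq_square algebra_simps)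
  moreover have "((\<lambda>x. of_real (bose_reg x) * of_real x powr (?s - 1)) has_integral Mellin_low ?s) {0<..1}"
    by (rule Mellin_low_strip(2)[of "(s - 1) / 2" _ 0]) (use assms in auto)
  ultimately have 2: "((\<lambda>x. of_real (bose_reg x) * of_real x powr (?s - 1)) has_integral
      (Mellin_low ?s + (Mellin_high ?s - (- 1 / (?s - 1)) + 1 / 2 * (- 1 / ?s)))) {0<..}"
    by (rule has_integral_split_at_1[rotated])
  have "complex_of_real ?I = of_real pi / cos (of_real pi * ?s / 2) * of_real (2 * pi) powr (?s - 1) * zeta_lim (1 - ?s)"
  proof -
    have "complex_of_real (cos (pi * s / 2)) = cos (of_real pi * ?s / 2)"
      by (simp flip: cos_of_real)
    moreover have "complex_of_real ((2 * pi) powr (s - 1)) = of_real (2 * pi) powr (?s - 1)"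
      using powr_of_real[of "2 * pi" "s - 1"] by simp
    moreover have "complex_of_real (Re (zeta_lim (of_real (1 - s)))) = zeta_lim (1 - ?s)"
      using zeta_lim_of_real(2)[of "1 - s"] assms by simp
    ultimately show ?thesis by (simp only: of_real_mult of_real_divide)
  qed
  with has_integral_unique[OF 1 2] show ?thesis by (simp add: Mellin_sum_def algebra_simps)
qed

section \<open>Analytic continuation and functional equation\<close>

text \<open>Identity theorem: the interval accumulates at its midpoint \<open>c\<close>. This
  carries identities proved for real arguments to complex ones.\<close>

lemma analytic_continuation_reals:
  fixes a b :: real
  assumes "f holomorphic_on S" "g holomorphic_on S" "open S" "connected S" "a < b"
    and "\<And>x. a < x \<Longrightarrow> x < b \<Longrightarrow> of_real x \<in> S \<and> f (of_real x) = g (of_real x)"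
    and "z \<in> S"
  shows "f z = g z"
proof -
  define c where "c = (a + b) / 2"
  have c: "a < c" "c < b" using assms(5) by (auto simp: c_def field_simps)
  have lim: "complex_of_real c islimpt of_real ` {a<..<b}"
    unfolding islimpt_approachable
  proof safe
    fix e :: real assume "e > 0"
    define x where "x = c + min (e / 2) ((b - c) / 2)"
    have "x \<in> {a<..<b}" "x \<noteq> c" "\<bar>x - c\<bar> < e"
      using c \<open>e > 0\<close> by (auto simp: x_def min_def field_simps)
    thus "\<exists>x'\<in>of_real ` {a<..<b}. x' \<noteq> complex_of_real c \<and> dist x' (of_real c) < e"
      by (intro bexI[of _ "of_real x"]) (auto simp: dist_of_real dist_real_def)
  qed
  have "f z - g z = 0"
  proof (rule analytic_continuation[of "\<lambda>z. f z - g z" S "of_real ` {a<..<b}" "of_real c"])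
    show "(\<lambda>z. f z - g z) holomorphic_on S" by (intro holomorphic_intros assms)
  qed (use assms c lim in auto)
  thus ?thesis by simp
qed

lemma open_strip: "open {s. a < Re s \<and> Re s < b}"
  by (intro open_Collect_conj open_halfspace_Re_gt open_halfspace_Re_lt)

lemma connected_strip: "connected {s. a < Re s \<and> Re s < b}"
  unfolding Collect_conj_eq
  by (intro convex_connected convex_Int convex_halfspace_Re_gt convex_halfspace_Re_lt)

text \<open>
  This is \<^term>\<open>rGamma s * Mellin_sum s\<close> with the removable singularity at \<open>0\<close> filled in, using
  \<open>rGamma s = s * rGamma (s + 1)\<close>.
\<close>

definition zeta_right :: "complex \<Rightarrow> complex" where
  "zeta_right s = rGamma s * (Mellin_low s + Mellin_high s + 1 / (s - 1)) - rGamma (s + 1) / 2"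

text \<open>The right-hand side of the functional equation. For Re s < 0 the argument 1 - s lies in
  the region of convergence of the Dirichlet series.\<close>

definition zeta_left :: "complex \<Rightarrow> complex" where
  "zeta_left s = 2 * of_real (2 * pi) powr (s - 1) * Gamma (1 - s) * sin (of_real pi * s / 2) * zeta_lim (1 - s)"

lemma zeta_right_altdef: "s \<noteq> 0 \<Longrightarrow> zeta_right s = rGamma s * Mellin_sum s"
  using rGamma_plus1[of s] by (simp add: zeta_right_def Mellin_sum_def field_simps)

lemma holomorphic_on_zeta_right: "zeta_right holomorphic_on {s. Re s > -1} - {1}"
  unfolding zeta_right_def[abs_def]
  by (intro holomorphic_intros holomorphic_on_subset[OF holomorphic_on_Mellin(1)]
      holomorphic_on_subset[OF holomorphic_on_Mellin(2)]) auto

lemma holomorphic_on_zeta_left: "zeta_left holomorphic_on {s. Re s < 0}"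
proof -
  have "(\<lambda>s. zeta_lim (1 - s)) holomorphic_on {s. Re s < 0}"
    by (rule holomorphic_on_compose_gen[OF _ holomorphic_on_zeta_lim, unfolded o_def])
       (auto intro!: holomorphic_intros)
  thus ?thesis unfolding zeta_left_def[abs_def]
    by (intro holomorphic_intros) (auto elim!: nonpos_Ints_cases simp: complex_eq_iff)
qed

lemma zeta_right_eq_zeta_lim:
  assumes "Re s > 1"
  shows "zeta_right s = zeta_lim s"
proof (rule analytic_continuation_reals[of zeta_right "{s. Re s > 1}" zeta_lim 1 2])
  show "zeta_right holomorphic_on {s. Re s > 1}"
    by (rule holomorphic_on_subset[OF holomorphic_on_zeta_right]) auto
  show "zeta_lim holomorphic_on {s. Re s > 1}"
    by (rule holomorphic_on_subset[OF holomorphic_on_zeta_lim]) auto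
  show "connected {s. Re s > 1}" by (intro convex_connected convex_halfspace_Re_gt)
  fix x :: real assume x: "1 < x" "x < 2"
  have "rGamma (complex_of_real x) * Gamma (of_real x) = 1"
  proof -
    have "Gamma x \<noteq> 0" using Gamma_real_pos[of x] x by linarith
    thus ?thesis unfolding rGamma_inverse_Gamma Gamma_complex_of_real by simp
  qed
  thus "of_real x \<in> {s. Re s > 1} \<and> zeta_right (of_real x) = zeta_lim (of_real x)"
    using x by (simp add: zeta_right_altdef Mellin_sum_gt_1 flip: mult.assoc)
qed (use assms open_halfspace_Re_gt in auto)

text \<open>At real arguments, reflection gives 1/Gamma(s) = Gamma(1 - s) sin(pi s) / pi. Doubling
  the angle in the sine yields a factor cos(pi s / 2), which cancels the denominator in
  \<open>Mellin_sum_neg\<close>.\<close>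

lemma zeta_right_eq_zeta_left:
  assumes "-1 < Re s" "Re s < 0"
  shows "zeta_right s = zeta_left s"
proof (rule analytic_continuation_reals[of zeta_right "{s. -1 < Re s \<and> Re s < 0}" zeta_left "-1" 0])
  show "zeta_right holomorphic_on {s. -1 < Re s \<and> Re s < 0}"
    by (rule holomorphic_on_subset[OF holomorphic_on_zeta_right]) auto
  show "zeta_left holomorphic_on {s. -1 < Re s \<and> Re s < 0}"
    by (rule holomorphic_on_subset[OF holomorphic_on_zeta_left]) auto
  show "open {s. -1 < Re s \<and> Re s < 0}"
    by (rule open_strip)
  show "connected {s. -1 < Re s \<and> Re s < 0}"
    by (rule connected_strip)
  fix x :: real assume x: "-1 < x" "x < 0"
  let ?s = "complex_of_real x"
  have cos: "cos (of_real pi * ?s / 2) \<noteq> 0"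
  proof -
    have "cos (pi * x / 2) > 0" using x mult_strict_left_mono[of "-1" x pi]
      by (intro cos_gt_zero_pi) (auto simp: field_simps mult_neg_pos)
    hence "complex_of_real (cos (pi * x / 2)) \<noteq> 0" by simp
    thus ?thesis by (simp flip: cos_of_real)
  qed
  have "rGamma (1 - ?s) \<noteq> 0"
  proof
    assume "rGamma (1 - ?s) = 0"
    then obtain n where "1 - ?s = of_int n" "n \<le> 0"
      unfolding rGamma_eq_zero_iff by (elim nonpos_Ints_cases)
    thus False using x by (auto simp: complex_eq_iff)
  qed
  hence "rGamma ?s = Gamma (1 - ?s) * sin (of_real pi * ?s) / of_real pi"
    using rGamma_reflection_complex[of ?s] by (simp add: Gamma_def field_simps)
  also have "sin (of_real pi * ?s) = 2 * sin (of_real pi * ?s / 2) * cos (of_real pi * ?s / 2)"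
    using sin_double[of "of_real pi * ?s / 2"] by simp
  finally have "rGamma ?s = 2 * Gamma (1 - ?s) * sin (of_real pi * ?s / 2) * cos (of_real pi * ?s / 2) / of_real pi"
    by simp
  hence "zeta_right ?s = zeta_left ?s"
    using x cos by (simp add: zeta_right_altdef Mellin_sum_neg zeta_left_def)
  thus "?s \<in> {s. -1 < Re s \<and> Re s < 0} \<and> zeta_right ?s = zeta_left ?s" using x by simp
qed (use assms in auto)

section \<open>Existence and uniqueness of the continuation\<close>

text \<open>The two formulas agree on the overlap -1 < Re s < 0, so they glue to a function on the
  punctured plane. This witness is what makes the choice in \<open>zeta\<close> meaningful.\<close>

lemma zeta_exists:
  defines "f \<equiv> (\<lambda>s. if -1 < Re s then zeta_right s else zeta_left s)"
  shows "f holomorphic_on - {1}" "\<And>s. Re s > 1 \<Longrightarrow> (\<lambda>n. of_nat (Suc n) powr (- s)) sums f s"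
proof -
  have "f holomorphic_on ({s. -1 < Re s} - {1}) \<union> {s. Re s < 0}"
  proof (rule holomorphic_on_Un)
    show "f holomorphic_on {s. -1 < Re s} - {1}"
      by (rule holomorphic_transform[OF holomorphic_on_zeta_right]) (auto simp: f_def)
    show "f holomorphic_on {s. Re s < 0}"
      by (rule holomorphic_transform[OF holomorphic_on_zeta_left]) (auto simp: f_def zeta_right_eq_zeta_left)
  qed (auto intro: open_right_half_plane_delete open_halfspace_Re_lt)
  thus "f holomorphic_on - {1}" by (rule holomorphic_on_subset) auto
  show "(\<lambda>n. of_nat (Suc n) powr (- s)) sums f s" if "Re s > 1" for s
    using sums_zeta_lim[OF that] that by (simp add: f_def zeta_right_eq_zeta_lim)
qed

lemma holomorphic_on_zeta: "zeta holomorphic_on - {1}"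
  and sums_zeta: "Re s > 1 \<Longrightarrow> (\<lambda>n. of_nat (Suc n) powr (- s)) sums zeta s"
proof -
  have "\<exists>f. f holomorphic_on (- {1}) \<and> (\<forall>s. Re s > 1 \<longrightarrow> (\<lambda>n. of_nat (Suc n) powr (- s)) sums f s)"
    using zeta_exists by blast
  from someI_ex[OF this, folded zeta_def]
  show "zeta holomorphic_on - {1}" "Re s > 1 \<Longrightarrow> (\<lambda>n. of_nat (Suc n) powr (- s)) sums zeta s"
    by blast+
qed

lemma zeta_eqI:
  assumes "f holomorphic_on S" "open S" "connected S" "S \<subseteq> - {1}" "{s. Re s > 1} \<subseteq> S"
    and "\<And>s. Re s > 1 \<Longrightarrow> f s = zeta_lim s" and "s \<in> S"
  shows "zeta s = f s"
proof (rule analytic_continuation_open[of "{s. Re s > 1}" S zeta f])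
  show "zeta holomorphic_on S" by (rule holomorphic_on_subset[OF holomorphic_on_zeta assms(4)])
  show "{s. Re s > 1} \<noteq> {}" by (auto intro: exI[of _ 2])
  show "zeta s = f s" if "s \<in> {s. Re s > 1}" for s
    using that assms(6)[of s] sums_unique2[OF sums_zeta sums_zeta_lim] by auto
qed (use assms open_halfspace_Re_gt in auto)

lemma zeta_eq_zeta_lim: "Re s > 0 \<Longrightarrow> s \<noteq> 1 \<Longrightarrow> zeta s = zeta_lim s"
  by (rule zeta_eqI[OF holomorphic_on_zeta_lim open_right_half_plane_delete
      connected_right_half_plane_delete]) auto

lemma zeta_eq_zeta_right: "Re s > -1 \<Longrightarrow> s \<noteq> 1 \<Longrightarrow> zeta s = zeta_right s"
  by (rule zeta_eqI[OF holomorphic_on_zeta_right open_right_half_plane_delete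
      connected_right_half_plane_delete]) (auto simp: zeta_right_eq_zeta_lim)

text \<open>On -1 < Re s < 0 this is the agreement of \<open>zeta_right\<close> and
  \<open>zeta_left\<close>. Both sides are holomorphic for Re s < 1 away from 0, where 1 - s would
  meet the pole, and the identity theorem extends the equation.\<close>

theorem zeta_functional_equation:
  assumes "Re s < 1" "s \<noteq> 0"
  shows "zeta s = 2 * of_real (2 * pi) powr (s - 1) * Gamma (1 - s) * sin (of_real pi * s / 2) * zeta (1 - s)"
proof (rule analytic_continuation_open[of "{s. -1 < Re s \<and> Re s < 0}" "{s. Re s < 1} - {0}" zeta])
  show "open {s. -1 < Re s \<and> Re s < 0}"
    by (rule open_strip)
  show "open ({s. Re s < 1} - {0})" by (intro open_delete open_halfspace_Re_lt)
  have "- (1/2) \<in> {s. -1 < Re s \<and> Re s < 0}" by simp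
  thus "{s. -1 < Re s \<and> Re s < 0} \<noteq> {}" by blast
  show "connected ({s. Re s < 1} - {0})"
    by (intro connected_open_delete open_halfspace_Re_lt convex_connected convex_halfspace_Re_lt) auto
  show "zeta holomorphic_on {s. Re s < 1} - {0}"
    by (rule holomorphic_on_subset[OF holomorphic_on_zeta]) auto
  have "(\<lambda>s. zeta (1 - s)) holomorphic_on {s. Re s < 1} - {0}"
    by (rule holomorphic_on_compose_gen[OF _ holomorphic_on_zeta, unfolded o_def])
       (auto intro!: holomorphic_intros)
  thus "(\<lambda>s. 2 * of_real (2 * pi) powr (s - 1) * Gamma (1 - s) * sin (of_real pi * s / 2) * zeta (1 - s))
      holomorphic_on {s. Re s < 1} - {0}"
    by (intro holomorphic_intros) (auto elim!: nonpos_Ints_cases simp: complex_eq_iff)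
  fix s assume s: "s \<in> {s. -1 < Re s \<and> Re s < 0}"
  hence "s \<noteq> 1" by auto
  with s have "zeta s = zeta_left s" by (simp add: zeta_eq_zeta_right zeta_right_eq_zeta_left)
  also have "zeta_lim (1 - s) = zeta (1 - s)" using s by (intro zeta_eq_zeta_lim[symmetric]) auto
  hence "zeta_left s = 2 * of_real (2 * pi) powr (s - 1) * Gamma (1 - s) * sin (of_real pi * s / 2) * zeta (1 - s)"
    by (simp add: zeta_left_def)
  finally show "zeta s = \<dots>" .
qed (use assms in auto)

section \<open>Zeros of the approximants\<close>

lemma uniform_limit_H_zeta:
  assumes "compact K" "K \<subseteq> {s. Re s > 0} - {1}"
  shows "uniform_limit K H zeta sequentially"
proof -
  have "zeta s = zeta_lim s" if "s \<in> K" for s using that assms(2) by (intro zeta_eq_zeta_lim) auto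
  thus ?thesis using uniform_limit_H_zeta_lim[OF assms] by (simp cong: uniform_limit_cong')
qed

text \<open>Constancy on \<open>U\<close> would spread to the whole punctured plane, but the sine
  factor forces a zero at -2 while the series at 2 is positive. Hurwitz's theorem requires a
  nonconstant limit.\<close>

lemma zeta_not_constant_on:
  assumes "open U" "U \<noteq> {}" "U \<subseteq> - {1}"
  shows "\<not> zeta constant_on U"
proof
  assume "zeta constant_on U"
  then obtain c where c: "\<And>s. s \<in> U \<Longrightarrow> zeta s = c" unfolding constant_on_def by blast
  have const: "zeta s = c" if "s \<noteq> 1" for s
  proof (rule analytic_continuation_open[of U "- {1}" zeta "\<lambda>_. c"])
    show "connected (- {1 :: complex})" by (intro connected_punctured_universe) simp
    show "U \<noteq> {}" by fact
  qed (use assms(1,3) c that holomorphic_on_zeta in auto)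
  have "zeta (-2) = 0"
    by (subst zeta_functional_equation) auto
  hence "zeta 2 = 0" using const[of 2] const[of "-2"] by simp
  have "(\<lambda>n. real (Suc n) powr (-2)) sums Re (zeta_lim 2)"
    using zeta_lim_of_real(1)[of 2] by simp
  moreover have "zeta_lim 2 = zeta 2" by (rule zeta_eq_zeta_lim[symmetric]) auto
  ultimately have "(\<lambda>n. real (Suc n) powr (-2)) sums 0" using \<open>zeta 2 = 0\<close> by simp
  thus False
    using suminf_pos[of "\<lambda>n. real (Suc n) powr (-2)"] by (auto simp: sums_iff)
qed

text \<open>|zeta| has a positive minimum on \<open>K\<close>; once \<open>H N\<close> is uniformly
  closer to zeta than that, it cannot vanish there.\<close>

lemma eventually_H_nonzero:
  assumes "compact K" "K \<subseteq> {s. Re s > 0} - {1}" "\<And>s. s \<in> K \<Longrightarrow> zeta s \<noteq> 0"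
  shows "\<forall>\<^sub>F N in sequentially. \<forall>s\<in>K. H N s \<noteq> 0"
proof (cases "K = {}")
  case False
  have "continuous_on K (\<lambda>s. norm (zeta s))"
    using assms(2) by (intro continuous_intros holomorphic_on_imp_continuous_on
        holomorphic_on_subset[OF holomorphic_on_zeta]) auto
  from continuous_attains_inf[OF assms(1) False this] obtain z where
    z: "z \<in> K" "\<And>s. s \<in> K \<Longrightarrow> norm (zeta z) \<le> norm (zeta s)" by blast
  have "norm (zeta z) > 0" using assms(3) z(1) by simp
  from uniform_limitD[OF uniform_limit_H_zeta[OF assms(1,2)] this] show ?thesis
  proof eventually_elim
    case (elim N)
    show ?case
    proof
      fix s assume s: "s \<in> K"
      have "dist (H N s) (zeta s) < norm (zeta s)" using elim s z(2)[OF s] by force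
      thus "H N s \<noteq> 0" by auto
    qed
  qed
qed auto

text \<open>Enumerating the good indices gives a subsequence that is zero-free on the disc and still
  converges locally uniformly to zeta, so Hurwitz's theorem applies to it.\<close>

lemma zeta_nonzero_if_infinitely_often_H_nonzero:
  assumes "r > 0" "cball z r \<subseteq> {s. Re s > 0} - {1}"
    and "infinite {N. \<forall>s\<in>cball z r. H N s \<noteq> 0}"
  shows "zeta z \<noteq> 0"
proof -
  have sub: "ball z r \<subseteq> - {1}" using assms(2) ball_subset_cball by blast
  define \<nu> where "\<nu> = enumerate {N. \<forall>s\<in>cball z r. H N s \<noteq> 0}"
  have \<nu>: "strict_mono \<nu>" "\<And>n s. s \<in> cball z r \<Longrightarrow> H (\<nu> n) s \<noteq> 0"
    unfolding \<nu>_def using enumerate_in_set[OF assms(3)] strict_mono_enumerate[OF assms(3)] by auto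
  show ?thesis
  proof (rule Hurwitz_no_zeros[of "ball z r" "\<lambda>n. H (\<nu> n)" zeta])
    show "H (\<nu> n) holomorphic_on ball z r" for n
      by (rule holomorphic_on_subset[OF holomorphic_on_H sub])
    show "zeta holomorphic_on ball z r"
      by (rule holomorphic_on_subset[OF holomorphic_on_zeta sub])
    show "uniform_limit K (\<lambda>n. H (\<nu> n)) zeta sequentially" if "compact K" "K \<subseteq> ball z r" for K
    proof -
      have "uniform_limit K H zeta sequentially"
        using that assms(2) ball_subset_cball by (intro uniform_limit_H_zeta) blast+
      from filterlim_compose[OF this filterlim_subseq[OF \<nu>(1)]] show ?thesis .
    qed
    show "\<not> zeta constant_on ball z r"
      using assms(1) sub by (intro zeta_not_constant_on) auto
  qed (use \<nu> assms in auto)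
qed

theorem theorem3p1:
  fixes R :: "complex set"
  assumes "R = {s. 1 / 2 < Re s \<and> Re s < 1} \<or> R = {s. 0 < Re s \<and> Re s < 1 / 2}"
  shows "Riemann_Hypothesis \<longleftrightarrow>
    (\<forall>K. (\<exists>z r. r > 0 \<and> K = cball z r) \<and> K \<subseteq> R \<longrightarrow>
      (\<exists>N\<^sub>0::nat. infinite {N. N > N\<^sub>0 \<and> (\<forall>s\<in>K. H N s \<noteq> 0)}))" (is "_ \<longleftrightarrow> ?rhs")
proof -
  have R: "R \<subseteq> {s. Re s > 0} - {1}" "open R"
    using assms open_strip[of "1 / 2" 1] open_strip[of 0 "1 / 2"] by auto
  show ?thesis
  proof
    assume RH: Riemann_Hypothesis
    show ?rhs
    proof (intro allI impI exI[of _ 0])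
      fix K assume K: "(\<exists>z r. r > 0 \<and> K = cball z r) \<and> K \<subseteq> R"
      hence "compact K" "K \<subseteq> R" by auto
      have "\<forall>\<^sub>F N in sequentially. \<forall>s\<in>K. H N s \<noteq> 0"
      proof (rule eventually_H_nonzero)
        show "zeta s \<noteq> 0" if "s \<in> K" for s
        proof -
          have "s \<in> R" using that \<open>K \<subseteq> R\<close> by blast
          hence "0 < Re s" "Re s < 1" "Re s \<noteq> 1 / 2" using assms by auto
          thus ?thesis using RH unfolding Riemann_Hypothesis_def by blast
        qed
      qed (fact \<open>compact K\<close>, rule order_trans[OF \<open>K \<subseteq> R\<close> R(1)])
      hence "\<forall>\<^sub>F N in sequentially. N > 0 \<and> (\<forall>s\<in>K. H N s \<noteq> 0)"
        by (intro eventually_conj eventually_gt_at_top)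
      \<comment> \<open>The Riemann Hypothesis gives all late N, which is more than the infinitely
        many asked for.\<close>
      hence "\<exists>\<^sub>F N in sequentially. N > 0 \<and> (\<forall>s\<in>K. H N s \<noteq> 0)"
        by (rule eventually_frequently[rotated]) simp
      thus "infinite {N. N > 0 \<and> (\<forall>s\<in>K. H N s \<noteq> 0)}"
        unfolding cofinite_eq_sequentially[symmetric] frequently_cofinite .
    qed
  next
    assume rhs: ?rhs
    have nz: "zeta z \<noteq> 0" if z: "z \<in> R" for z
    proof -
      obtain r where r: "r > 0" "cball z r \<subseteq> R"
        using R(2) z unfolding open_contains_cball by blast
      have "\<exists>N\<^sub>0. infinite {N. N > N\<^sub>0 \<and> (\<forall>s\<in>cball z r. H N s \<noteq> 0)}"
        using r by (intro rhs[rule_format]) auto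
      then obtain N\<^sub>0 where "infinite {N. N > N\<^sub>0 \<and> (\<forall>s\<in>cball z r. H N s \<noteq> 0)}" ..
      hence "infinite {N. \<forall>s\<in>cball z r. H N s \<noteq> 0}"
        by (rule infinite_super[rotated]) auto
      with r R(1) show ?thesis
        by (intro zeta_nonzero_if_infinitely_often_H_nonzero[of r]) auto
    qed
    show Riemann_Hypothesis
      unfolding Riemann_Hypothesis_def
    proof (intro allI impI)
      fix s assume s: "0 < Re s \<and> Re s < 1 \<and> zeta s = 0"
      hence "s \<noteq> 1" by auto
      \<comment> \<open>The functional equation at 1 - s contains zeta(s) as a factor; s different
        from 1 is its side condition there.\<close>
      hence "zeta (1 - s) = 0"
        using zeta_functional_equation[of "1 - s"] s by simp
      \<comment> \<open>The map from s to 1 - s swaps the two half strips, so a zero off the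
        critical line would put s or 1 - s into \<open>R\<close>, whichever half \<open>R\<close>
        is.\<close>
      hence "s \<notin> R" "1 - s \<notin> R" using nz s by blast+
      thus "Re s = 1 / 2" using assms s by auto
    qed
  qed
qed

end
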